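(* Let $\{a_k\}_{k\ge 0}\in\mathcal{S}_{-}$. Let $n$ be a positive odd integer and let $p$ be a prime such that $p>n+1$. Then $$\sum_{0<k_1<\cdots<k_{n}<p}\frac{a_{p-k_{n}}}{k_1\cdots k_{n}}\equiv \frac{p(n+1)}{2}\sum_{0<k_1<\cdots<k_{n+1}<p}\frac{a_{p-k_{n+1}}}{k_1\cdots k_{n+1}}\pmod{p^3}.$$
   Context: Let $T$ be the binomial transform, the linear transformation of sequences given by $T(\{a_r\})=\left\{\sum_{k=0}^{r}\binom{r}{k}(-1)^k a_k\right\}$, where $r\ge 0$. It is an involution, so its only eigenvalues are $1$ and $-1$. $\mathcal{S}_{-}$ denotes the eigenspace of $T$ corresponding to the eigenvalue $-1$, i.e. the set of sequences $\{a_k\}_{k\ge 0}$ satisfying $\sum_{k=0}^{r}\binom{r}{k}(-1)^k a_k=-a_r$ for all integers $r\ge 0$. The sums run over all tuples of integers $k_1<k_2<\cdots$ in the indicated range.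
   Formalization: The sequence is taken to be rational with a_k p-integral for 0<k≤p-n (the terms that occur); without p-integrality the congruence mod p^3 fails, e.g. for n=1, p=5 after dividing a suitable integral sequence by 5. *)

theory Defs
  imports Complex_Main "HOL-Computational_Algebra.Primes"
begin

definition binomial_transform :: "(nat \<Rightarrow> 'a::comm_ring_1) \<Rightarrow> nat \<Rightarrow> 'a" where
  "binomial_transform a = (\<lambda>r. \<Sum>k=0..r. of_nat (r choose k) * (-1) ^ k * a k)"

definition S_minus :: "(nat \<Rightarrow> 'a::comm_ring_1) set" where
  "S_minus = {a. \<forall>r. binomial_transform a r = - a r}"

text \<open>Congruences between rationals modulo a power of a prime p are taken in the ring of
  p-integral rationals, i.e. those whose reduced denominator is not divisible by p.\<close>

definition p_integral :: "nat \<Rightarrow> rat \<Rightarrow> bool" where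
  "p_integral p x \<longleftrightarrow> \<not> int p dvd snd (quotient_of x)"

definition p_cong :: "nat \<Rightarrow> nat \<Rightarrow> rat \<Rightarrow> rat \<Rightarrow> bool" where
  "p_cong p m x y \<longleftrightarrow> (\<exists>z. p_integral p z \<and> x - y = of_nat p ^ m * z)"

text \<open>A tuple of integers with 0 < k_1 < ... < k_n < p is encoded as a strictly increasing
  list, whose last element is k_n.\<close>

definition increasing_tuples :: "nat \<Rightarrow> nat \<Rightarrow> nat list set" where
  "increasing_tuples n p = {ks. length ks = n \<and> sorted_wrt (<) ks \<and> set ks \<subseteq> {0<..<p}}"

definition multiple_sum :: "(nat \<Rightarrow> rat) \<Rightarrow> nat \<Rightarrow> nat \<Rightarrow> rat" where
  "multiple_sum a n p =
     (\<Sum>ks\<in>increasing_tuples n p. a (p - last ks) / of_nat (prod_list ks))"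

end

(* Put F(x) = a_p + S_1 x + S_2 x^2 + ..., where S_n is the multiple sum of the theorem.  Since
   x (1 + x/1) ... (1 + x/(m-1)) / m = (x+m-1 choose m) = (-1)^m (-x choose m), one has
   F(x) = sum_k (-1)^(p-k) a_k (-x choose p-k).  Replacing a by -T(a) and applying Vandermonde's
   convolution turns this into F(x) = - sum_j (-1)^j a_j (x+p choose p-j), which for odd p is
   F(-p-x).  Comparing the coefficients of x^n in F(x) = F(-p-x) for odd n gives
   2 S_n = (n+1) p S_(n+1) - (n+2 choose 2) p^2 S_(n+2) + O(p^3), and the same comparison for
   n + 2 gives p | S_(n+2), so that the p^2-term is absorbed in O(p^3). *)

theory Submission
  imports Defs "HOL-Computational_Algebra.Polynomial"
    "HOL-Computational_Algebra.Formal_Power_Series"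
begin

section \<open>p-integral rationals\<close>

text \<open>Reduction only shrinks the denominator: a reduced denominator divides that of any other
  representation. Any fraction with denominator prime to \<open>p\<close> is therefore a
  certificate, and the closure lemmas become plain fraction arithmetic.\<close>

lemma p_integral_iff:
  assumes "prime p"
  shows "p_integral p x \<longleftrightarrow> (\<exists>u v. \<not> int p dvd v \<and> x = of_int u / of_int v)"
proof
  assume "p_integral p x"
  then show "\<exists>u v. \<not> int p dvd v \<and> x = of_int u / of_int v"
    unfolding p_integral_def by (metis prod.collapse quotient_of_div)
next
  assume "\<exists>u v. \<not> int p dvd v \<and> x = of_int u / of_int v"
  then obtain u v where v: "\<not> int p dvd v" and x: "x = of_int u / of_int v" by blast
  obtain r s where q: "quotient_of x = (r, s)" by fastforce
  have "s > 0" "coprime r s"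
    using q by (auto dest: quotient_of_denom_pos quotient_of_coprime)
  have "v \<noteq> 0" using v by auto
  have "(of_int u :: rat) / of_int v = of_int r / of_int s"
    using quotient_of_div[OF q] x by simp
  then have "(of_int (u * s) :: rat) = of_int (r * v)"
    using \<open>s > 0\<close> \<open>v \<noteq> 0\<close> by (simp add: field_simps)
  then have "u * s = r * v" by (simp only: of_int_eq_iff)
  then have "s dvd r * v" by (metis dvd_triv_right)
  then have "s dvd v" using \<open>coprime r s\<close> by (simp add: coprime_commute coprime_dvd_mult_right_iff)
  then show "p_integral p x"
    using v q unfolding p_integral_def by (auto dest: dvd_trans)
qed

lemma p_integral_of_int: "prime p \<Longrightarrow> p_integral p (of_int u)"
  unfolding p_integral_def by (auto dest: prime_gt_1_nat)

lemma p_integral_of_nat: "prime p \<Longrightarrow> p_integral p (of_nat u)"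
  using p_integral_of_int[of p "int u"] by simp

lemma p_integral_add:
  assumes "prime p" "p_integral p x" "p_integral p y"
  shows "p_integral p (x + y)"
proof -
  obtain u v r s where "\<not> int p dvd v" "x = of_int u / of_int v"
    "\<not> int p dvd s" "y = of_int r / of_int s"
    using assms by (auto simp: p_integral_iff)
  moreover from this have "v \<noteq> 0" "s \<noteq> 0" by auto
  ultimately have "x + y = of_int (u * s + r * v) / of_int (v * s)" "\<not> int p dvd v * s"
    using assms(1) by (auto simp: field_simps prime_dvd_mult_iff)
  then show ?thesis unfolding p_integral_iff[OF assms(1)] by blast
qed

lemma p_integral_mult:
  assumes "prime p" "p_integral p x" "p_integral p y"
  shows "p_integral p (x * y)"
proof -
  obtain u v r s where "\<not> int p dvd v" "x = of_int u / of_int v"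
    "\<not> int p dvd s" "y = of_int r / of_int s"
    using assms by (auto simp: p_integral_iff)
  then have "x * y = of_int (u * r) / of_int (v * s)" "\<not> int p dvd v * s"
    using assms(1) by (auto simp: prime_dvd_mult_iff)
  then show ?thesis unfolding p_integral_iff[OF assms(1)] by blast
qed

lemma p_integral_uminus:
  assumes "prime p" "p_integral p x"
  shows "p_integral p (- x)"
  using p_integral_mult[OF assms(1) p_integral_of_int[OF assms(1), of "- 1"] assms(2)] by simp

lemma p_integral_power:
  assumes "prime p" "p_integral p x"
  shows "p_integral p (x ^ k)"
  using p_integral_of_nat[OF assms(1), of 1]
  by (induction k) (auto intro: p_integral_mult assms)

lemma p_integral_sum:
  assumes "prime p" "\<And>i. i \<in> A \<Longrightarrow> p_integral p (f i)"
  shows "p_integral p (sum f A)"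
  using assms(2) p_integral_of_nat[OF assms(1), of 0]
  by (induction A rule: infinite_finite_induct) (auto intro: p_integral_add assms(1))

lemma p_integral_inverse_of_nat:
  assumes "prime p" "0 < m" "m < p"
  shows "p_integral p (1 / of_nat m)"
proof -
  have "\<not> int p dvd int m" using assms by (auto dest: dvd_imp_le)
  moreover have "1 / of_nat m = (of_int 1 / of_int (int m) :: rat)" by simp
  ultimately show ?thesis using assms(1) unfolding p_integral_iff[OF assms(1)] by blast
qed

section \<open>The generating polynomial\<close>

text \<open>Generating polynomial of the elementary symmetric functions of 1, 1/2, ..., 1/(m-1),
  that is, of the multiple harmonic sums below \<open>m\<close>.\<close>

definition harmonic_poly :: "nat \<Rightarrow> rat poly" where
  "harmonic_poly m = (\<Prod>j\<in>{1..<m}. [:1, 1 / of_nat j:])"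

text \<open>The polynomial F of the overview. The index \<open>m\<close> stands for the largest
  entry of a tuple, and \<open>pCons 0\<close> counts that entry. The constant term
  \<open>a p\<close> is what the term \<open>m = 0\<close> becomes in the binomial form
  \<open>poly_sum_poly\<close>.\<close>

definition sum_poly :: "(nat \<Rightarrow> rat) \<Rightarrow> nat \<Rightarrow> rat poly" where
  "sum_poly a p =
     [:a p:] + (\<Sum>m\<in>{0<..<p}. smult (a (p - m) / of_nat m) (pCons 0 (harmonic_poly m)))"

lemma harmonic_poly_Suc:
  assumes "0 < m"
  shows "harmonic_poly (Suc m) = harmonic_poly m * [:1, 1 / of_nat m:]"
  using assms unfolding harmonic_poly_def by (simp add: prod.atLeastLessThan_Suc)

text \<open>Splits off the largest entry \<open>m\<close>, the one on which the numerator
  \<open>a (p - m)\<close> depends.\<close>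

lemma increasing_tuples_Suc:
  "increasing_tuples (Suc n) p = (\<Union>m\<in>{0<..<p}. (\<lambda>ks. ks @ [m]) ` increasing_tuples n m)"
proof (intro equalityI subsetI)
  fix ks assume ks: "ks \<in> increasing_tuples (Suc n) p"
  then have "ks \<noteq> []" by (auto simp: increasing_tuples_def)
  then obtain js m where "ks = js @ [m]" by (metis append_butlast_last_id)
  moreover from ks this have "js \<in> increasing_tuples n m" "m \<in> {0<..<p}"
    by (auto simp: increasing_tuples_def sorted_wrt_append)
  ultimately show "ks \<in> (\<Union>m\<in>{0<..<p}. (\<lambda>ks. ks @ [m]) ` increasing_tuples n m)"
    by blast
qed (fastforce simp: increasing_tuples_def sorted_wrt_append)

lemma finite_increasing_tuples: "finite (increasing_tuples n p)"
  by (rule finite_subset[OF _ finite_lists_length_eq[of "{0<..<p}" n]])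
    (auto simp: increasing_tuples_def)

lemma sum_increasing_tuples_Suc:
  fixes f :: "nat list \<Rightarrow> 'a::comm_monoid_add"
  shows "(\<Sum>ks\<in>increasing_tuples (Suc n) p. f ks) =
    (\<Sum>m\<in>{0<..<p}. \<Sum>ks\<in>increasing_tuples n m. f (ks @ [m]))"
proof -
  have "(\<Sum>ks\<in>increasing_tuples (Suc n) p. f ks) =
      (\<Sum>m\<in>{0<..<p}. sum f ((\<lambda>ks. ks @ [m]) ` increasing_tuples n m))"
    unfolding increasing_tuples_Suc
    by (rule sum.UNION_disjoint) (auto simp: finite_increasing_tuples)
  also have "\<dots> = (\<Sum>m\<in>{0<..<p}. \<Sum>ks\<in>increasing_tuples n m. f (ks @ [m]))"
    by (subst sum.reindex) (auto simp: inj_on_def)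
  finally show ?thesis .
qed

text \<open>Both sides obey the same recursion in \<open>m\<close>: a tuple below
  \<open>Suc m\<close> either ends in \<open>m\<close>, which corresponds to choosing x/m in the new
  factor 1 + x/m, or lies below \<open>m\<close>.\<close>

lemma coeff_harmonic_poly:
  assumes "0 < m"
  shows "coeff (harmonic_poly m) n = (\<Sum>ks\<in>increasing_tuples n m. 1 / of_nat (prod_list ks))"
  using assms
proof (induction m arbitrary: n rule: nat_induct_non_zero)
  case 1
  have "{0<..<Suc 0} = {}" by auto
  then have "increasing_tuples n (Suc 0) = (if n = 0 then {[]} else {})"
    by (auto simp: increasing_tuples_def)
  then show ?case by (simp add: harmonic_poly_def coeff_1)
next
  case (Suc m)
  show ?case
  proof (cases n)
    case 0
    have "increasing_tuples 0 k = {[]}" for k by (auto simp: increasing_tuples_def)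
    then show ?thesis using Suc 0 by (simp add: harmonic_poly_Suc coeff_mult)
  next
    case (Suc n')
    have "{0<..<Suc m} = insert m {0<..<m}" using \<open>0 < m\<close> by auto
    then have "(\<Sum>ks\<in>increasing_tuples n (Suc m). 1 / of_nat (prod_list ks)) =
      (\<Sum>ks\<in>increasing_tuples n' m. 1 / rat_of_nat (prod_list (ks @ [m]))) +
      (\<Sum>ks\<in>increasing_tuples n m. 1 / of_nat (prod_list ks))"
      unfolding Suc sum_increasing_tuples_Suc by simp
    also have "\<dots> = coeff (harmonic_poly m) n' / of_nat m + coeff (harmonic_poly m) n"
      by (simp add: Suc.IH sum_divide_distrib)
    finally show ?thesis
      using \<open>0 < m\<close> Suc by (simp add: harmonic_poly_Suc)
  qed
qed

lemma coeff_sum_poly_Suc: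
  "coeff (sum_poly a p) (Suc n) =
     (\<Sum>m\<in>{0<..<p}. a (p - m) / of_nat m * coeff (harmonic_poly m) n)"
  by (simp add: sum_poly_def coeff_sum)

lemma multiple_sum_eq_coeff:
  assumes "n > 0"
  shows "multiple_sum a n p = coeff (sum_poly a p) n"
proof -
  obtain k where "n = Suc k" using assms gr0_implies_Suc by blast
  then show ?thesis
    by (auto simp: coeff_sum_poly_Suc multiple_sum_def sum_increasing_tuples_Suc
        coeff_harmonic_poly sum_distrib_left intro!: sum.cong)
qed

lemma p_integral_coeff_harmonic_poly:
  assumes "prime p" "0 < m" "m \<le> p"
  shows "p_integral p (coeff (harmonic_poly m) n)"
  using assms(2,3)
proof (induction m arbitrary: n rule: nat_induct_non_zero)
  case 1
  show ?case
    using p_integral_of_nat[OF assms(1), of 0] p_integral_of_nat[OF assms(1), of 1]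
    by (simp add: harmonic_poly_def coeff_1)
next
  case (Suc m)
  have IH: "p_integral p (coeff (harmonic_poly m) k)" for k using Suc by simp
  show ?case
  proof (cases n)
    case 0
    then show ?thesis using Suc IH[of 0] by (simp add: harmonic_poly_Suc coeff_mult)
  next
    case (Suc k)
    have "p_integral p (coeff (harmonic_poly m) k * (1 / of_nat m) + coeff (harmonic_poly m) n)"
      using Suc.prems Suc.hyps
      by (intro p_integral_add p_integral_mult IH p_integral_inverse_of_nat assms(1)) auto
    then show ?thesis using Suc \<open>0 < m\<close> by (simp add: harmonic_poly_Suc add.commute)
  qed
qed

text \<open>A product of \<open>m - 1\<close> linear factors has degree at most
  \<open>m - 1\<close>.\<close>

lemma coeff_harmonic_poly_eq_0:
  assumes "0 < m" "m \<le> n"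
  shows "coeff (harmonic_poly m) n = 0"
  using assms
proof (induction m arbitrary: n rule: nat_induct_non_zero)
  case 1
  then show ?case by (simp add: harmonic_poly_def coeff_1)
next
  case (Suc m)
  then show ?case by (cases n) (simp_all add: harmonic_poly_Suc)
qed

text \<open>By the degree bound only the terms with \<open>m \<ge> j\<close> contribute to
  coefficient \<open>j\<close>. They involve \<open>a (p - m)\<close> with
  \<open>0 < p - m \<le> p - n\<close>, which is exactly the range where \<open>a\<close> is assumed
  p-integral.\<close>

lemma p_integral_coeff_sum_poly:
  assumes "prime p" "0 < n" "n \<le> j"
    and a: "\<And>k. 0 < k \<Longrightarrow> k \<le> p - n \<Longrightarrow> p_integral p (a k)"
  shows "p_integral p (coeff (sum_poly a p) j)"
proof -
  obtain i where j: "j = Suc i" using assms by (cases j) auto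
  have "p_integral p (a (p - m) / of_nat m * coeff (harmonic_poly m) i)" if m: "m \<in> {0<..<p}" for m
  proof (cases "m \<le> i")
    case True
    then show ?thesis
      using m p_integral_of_nat[OF assms(1), of 0] by (simp add: coeff_harmonic_poly_eq_0)
  next
    case False
    then have "p_integral p (a (p - m) * (1 / of_nat m) * coeff (harmonic_poly m) i)"
      using m j assms(3)
      by (intro p_integral_mult a p_integral_inverse_of_nat p_integral_coeff_harmonic_poly assms(1))
        auto
    then show ?thesis by simp
  qed
  then show ?thesis unfolding j coeff_sum_poly_Suc by (intro p_integral_sum assms(1))
qed

section \<open>The functional equation\<close>

text \<open>Both sides are the rising factorial x (x+1) ... (x+m-1) divided by m!. Passing to
  \<open>Suc m\<close> multiplies each by (x+m)/(m+1).\<close>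

lemma poly_harmonic_poly:
  assumes "0 < m"
  shows "x / of_nat m * poly (harmonic_poly m) x = (- 1) ^ m * (- x gchoose m)"
  using assms
proof (induction m rule: nat_induct_non_zero)
  case 1
  then show ?case by (simp add: harmonic_poly_def)
next
  case (Suc m)
  have "of_nat (Suc m) * (- x gchoose Suc m) = (- x - of_nat m) * (- x gchoose m)"
    using gbinomial_mult_1[of "- x" m] by (simp add: algebra_simps)
  then have "(- x gchoose Suc m) = - ((x + of_nat m) / of_nat (Suc m)) * (- x gchoose m)"
    by (simp add: field_simps del: of_nat_Suc)
  then have "(- 1) ^ Suc m * (- x gchoose Suc m) =
      (x + of_nat m) / of_nat (Suc m) * ((- 1) ^ m * (- x gchoose m))"
    by (simp del: of_nat_Suc)
  also have "\<dots> = (x + of_nat m) / of_nat (Suc m) * (x / of_nat m * poly (harmonic_poly m) x)"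
    using Suc.IH by simp
  also have "\<dots> = x / of_nat (Suc m) * poly (harmonic_poly (Suc m)) x"
    using \<open>0 < m\<close> by (simp add: harmonic_poly_Suc field_simps del: of_nat_Suc)
  finally show ?case by simp
qed

lemma poly_sum_poly:
  assumes "a 0 = 0"
  shows "poly (sum_poly a p) x = (\<Sum>k\<le>p. (- 1) ^ (p - k) * a k * (- x gchoose (p - k)))"
proof (cases p)
  case 0
  then show ?thesis by (simp add: sum_poly_def)
next
  case (Suc q)
  have "poly (sum_poly a p) x =
      a p + (\<Sum>m\<in>{0<..<p}. a (p - m) * (x / of_nat m * poly (harmonic_poly m) x))"
    by (simp add: sum_poly_def poly_sum mult_ac)
  also have "(\<Sum>m\<in>{0<..<p}. a (p - m) * (x / of_nat m * poly (harmonic_poly m) x)) =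
      (\<Sum>m\<in>{0<..<p}. (- 1) ^ m * a (p - m) * (- x gchoose m))"
    by (intro sum.cong refl) (simp add: poly_harmonic_poly del: times_divide_eq_left)
  also have "a p + \<dots> = (\<Sum>m\<le>p. (- 1) ^ m * a (p - m) * (- x gchoose m))"
  proof -
    \<comment> \<open>The index 0 accounts for \<open>a p\<close>, and the index \<open>p\<close>
      adds nothing because \<open>a 0 = 0\<close>.\<close>
    have "{..p} = insert 0 (insert p {0<..<p})" using Suc by auto
    then show ?thesis using assms Suc by simp
  qed
  also have "\<dots> = (\<Sum>k\<le>p. (- 1) ^ (p - k) * a k * (- x gchoose (p - k)))"
    by (rule sum.reindex_bij_witness[of _ "\<lambda>k. p - k" "\<lambda>k. p - k"]) auto
  finally show ?thesis .
qed

text \<open>With k = i + j, negating the upper index of (k choose j) = (k choose i) gives (-1)^i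
  (-j-1 choose i). The signs then combine to the constant (-1)^(p-j), Vandermonde sums the products
  to (-j-1-x choose p-j), and a second negation yields the right-hand side.\<close>

lemma sum_binomial_gbinomial:
  fixes x :: "'a::field_char_0"
  assumes "j \<le> p"
  shows "(\<Sum>k\<in>{j..p}. of_nat (k choose j) * ((- 1) ^ (p - k) * (- x gchoose (p - k)))) =
    (x + of_nat p gchoose (p - j))"
proof -
  have 1: "of_nat ((i + j) choose j) = (- 1) ^ i * ((- of_nat j - 1 :: 'a) gchoose i)" for i
  proof -
    have "of_nat ((i + j) choose j) = (of_nat ((i + j) choose i) :: 'a)"
      using binomial_symmetric[of j "i + j"] by simp
    also have "\<dots> = (of_nat (i + j) gchoose i)" by (simp add: binomial_gbinomial)
    also have "\<dots> = (- 1) ^ i * ((- of_nat j - 1) gchoose i)"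
      by (subst gbinomial_negated_upper) (simp add: algebra_simps)
    finally show ?thesis .
  qed
  have "(\<Sum>k\<in>{j..p}. of_nat (k choose j) * ((- 1) ^ (p - k) * (- x gchoose (p - k)))) =
    (\<Sum>i\<in>{0..p - j}. of_nat ((i + j) choose j) *
      ((- 1) ^ (p - j - i) * (- x gchoose (p - j - i))))"
    using assms by (intro sum.reindex_bij_witness[of _ "\<lambda>i. i + j" "\<lambda>k. k - j"]) auto
  also have "\<dots> = (\<Sum>i\<in>{0..p - j}. (- 1) ^ (p - j) *
      (((- of_nat j - 1) gchoose i) * (- x gchoose (p - j - i))))"
  proof (intro sum.cong refl)
    fix i assume "i \<in> {0..p - j}"
    then have "(- 1 :: 'a) ^ (p - j) = (- 1) ^ i * (- 1) ^ (p - j - i)"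
      by (metis atLeastAtMost_iff le_add_diff_inverse power_add)
    then show "of_nat ((i + j) choose j) * ((- 1) ^ (p - j - i) * (- x gchoose (p - j - i))) =
      (- 1) ^ (p - j) * (((- of_nat j - 1) gchoose i) * (- x gchoose (p - j - i)))"
      by (simp add: 1)
  qed
  also have "\<dots> = (- 1) ^ (p - j) * ((- of_nat j - 1 + - x) gchoose (p - j))"
    by (simp only: sum_distrib_left[symmetric] gbinomial_Vandermonde)
  also have "\<dots> = (x + of_nat p gchoose (p - j))"
    using assms by (subst (2) gbinomial_negated_upper) (simp add: of_nat_diff algebra_simps)
  finally show ?thesis .
qed

lemma S_minus_0:
  fixes a :: "nat \<Rightarrow> rat"
  assumes "a \<in> S_minus"
  shows "a 0 = 0"
proof -
  have "binomial_transform a 0 = - a 0" using assms by (simp add: S_minus_def)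
  then show ?thesis by (simp add: binomial_transform_def)
qed

lemma poly_sum_poly_reflect:
  assumes "a \<in> S_minus" "odd p"
  shows "poly (sum_poly a p) (- of_nat p - x) = poly (sum_poly a p) x"
proof -
  have T: "a k = - (\<Sum>j\<le>k. of_nat (k choose j) * (- 1) ^ j * a j)" for k
  proof -
    have "binomial_transform a k = - a k" using assms by (simp add: S_minus_def)
    then show ?thesis by (simp add: binomial_transform_def atMost_atLeast0)
  qed
  define g where "g k = (- 1) ^ (p - k) * (- x gchoose (p - k))" for k
  have "poly (sum_poly a p) x = (\<Sum>k\<le>p. a k * g k)"
    unfolding poly_sum_poly[of a, OF S_minus_0[OF assms(1)]] g_def by (simp add: mult_ac)
  also have "\<dots> = (\<Sum>k\<le>p. \<Sum>j\<le>k. - ((- 1) ^ j * a j * (of_nat (k choose j) * g k)))"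
    by (subst T) (simp add: sum_distrib_left sum_distrib_right sum_negf mult_ac)
  \<comment> \<open>Interchange of summation over the triangle \<open>j \<le> k \<le> p\<close>, so
    that the inner sum is the convolution above.\<close>
  also have "\<dots> = (\<Sum>j\<le>p. \<Sum>k\<in>{j..p}. - ((- 1) ^ j * a j * (of_nat (k choose j) * g k)))"
    by (simp add: sum.Sigma) (rule sum.reindex_bij_witness[of _ prod.swap prod.swap], auto)
  also have "\<dots> = (\<Sum>j\<le>p. - ((- 1) ^ j * a j * (x + of_nat p gchoose (p - j))))"
    by (intro sum.cong refl)
      (simp add: sum_binomial_gbinomial[symmetric] g_def sum_negf sum_distrib_left)
  also have "\<dots> = (\<Sum>j\<le>p. (- 1) ^ (p - j) * a j * (x + of_nat p gchoose (p - j)))"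
  proof (intro sum.cong refl)
    fix j assume "j \<in> {..p}"
    \<comment> \<open>For odd \<open>p\<close> this sign cancels the minus coming from the
      eigenvalue -1.\<close>
    then have "(- 1 :: rat) ^ (p - j) = - ((- 1) ^ j)"
      using assms(2) by (cases "even j") (auto simp: even_diff_nat)
    then show "- ((- 1) ^ j * a j * (x + of_nat p gchoose (p - j))) =
      (- 1) ^ (p - j) * a j * (x + of_nat p gchoose (p - j))" by simp
  qed
  also have "\<dots> = poly (sum_poly a p) (- of_nat p - x)"
    unfolding poly_sum_poly[of a, OF S_minus_0[OF assms(1)]] by (simp add: add.commute)
  finally show ?thesis by simp
qed

text \<open>Expand F(-c-x) by the binomial theorem: the coefficient of x^n in (-c-x)^j is (-1)^n (j
  choose n) (-c)^(j-n). Equality of values gives equality of polynomials in characteristic 0. The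
  bound \<open>N\<close> is left free so that the sum may be padded with zero coefficients.\<close>

lemma coeff_reflect:
  fixes F :: "'a::{comm_ring_1, ring_no_zero_divisors, ring_char_0} poly"
  assumes "\<And>x. poly F (- c - x) = poly F x" "degree F \<le> n + N"
  shows "coeff F n = (- 1) ^ n * (\<Sum>i\<le>N. coeff F (n + i) * of_nat ((n + i) choose n) * (- c) ^ i)"
proof -
  define G where "G = (\<Sum>j\<le>n + N. smult (coeff F j) ([:- c, - 1:] ^ j))"
  have F: "F = (\<Sum>j\<le>n + N. monom (coeff F j) j)"
    using poly_as_sum_of_monoms'[OF assms(2)] by simp
  have "poly G x = poly F x" for x
  proof -
    have "poly F x = poly F (- c - x)" using assms(1) by simp
    also have "\<dots> = (\<Sum>j\<le>n + N. coeff F j * (- c - x) ^ j)"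
      by (subst F) (simp add: poly_sum poly_monom)
    also have "\<dots> = poly G x" by (simp add: G_def poly_sum)
    finally show ?thesis by simp
  qed
  then have "F = G" by (simp add: poly_eq_poly_eq_iff[symmetric] fun_eq_iff)
  then have "coeff F n = (\<Sum>j\<le>n + N. coeff F j * coeff ([:- c, - 1:] ^ j) n)"
    by (metis (no_types, lifting) G_def coeff_smult coeff_sum sum.cong)
  also have "\<dots> = (\<Sum>j\<in>{n..n + N}. coeff F j * coeff ([:- c, - 1:] ^ j) n)"
  proof (rule sum.mono_neutral_right)
    have "coeff ([:- c, - 1:] ^ j) n = 0" if "j < n" for j
      using that degree_power_le[of "[:- c, - 1:]" j] by (intro coeff_eq_0) simp
    then show "\<forall>j\<in>{..n + N} - {n..n + N}. coeff F j * coeff ([:- c, - 1:] ^ j) n = 0" by auto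
  qed auto
  also have "\<dots> = (\<Sum>i\<le>N. coeff F (n + i) * coeff ([:- c, - 1:] ^ (n + i)) n)"
    by (rule sum.reindex_bij_witness[of _ "\<lambda>i. n + i" "\<lambda>j. j - n"]) auto
  also have "\<dots> = (- 1) ^ n * (\<Sum>i\<le>N. coeff F (n + i) * of_nat ((n + i) choose n) * (- c) ^ i)"
    by (simp add: coeff_linear_poly_power sum_distrib_left mult_ac)
  finally show ?thesis .
qed

theorem theorem1p1:
  fixes a :: "nat \<Rightarrow> rat" and n p :: nat
  assumes "a \<in> S_minus"
    and "n > 0" and "odd n"
    and "prime p" and "p > n + 1"
    and "\<And>k. 0 < k \<Longrightarrow> k \<le> p - n \<Longrightarrow> p_integral p (a k)"
  shows "p_cong p 3 (multiple_sum a n p)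
           (of_nat p * (of_nat n + 1) / 2 * multiple_sum a (n + 1) p)"
proof -
  define S where "S = coeff (sum_poly a p)"
  define N where "N = degree (sum_poly a p)"
  define P where "P = rat_of_nat p"
  define b where "b m i = rat_of_nat ((m + i) choose m)" for m i
  have p: "p > 2" using assms by (auto elim: oddE)
  then have "odd p" using assms(4) by (simp add: prime_odd_nat)
  \<comment> \<open>The terms of index at least 3 with P^3 taken out. Summing up to
    \<open>N + 3\<close> in \<open>reflect\<close> exceeds the degree and leaves exactly the indices
    \<open>i \<le> N\<close> here.\<close>
  define R where "R m = (\<Sum>i\<le>N. S (m + 3 + i) * b m (i + 3) * (- P) ^ i)" for m
  have reflect: "S m = - (\<Sum>i\<le>N + 3. S (m + i) * b m i * (- P) ^ i)" if "odd m" for m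
    using coeff_reflect[of "sum_poly a p" P m "N + 3"] that
      poly_sum_poly_reflect[OF assms(1) \<open>odd p\<close>]
    by (simp add: S_def N_def P_def b_def)
  \<comment> \<open>The term \<open>i = 0\<close> of \<open>reflect\<close> is \<open>- S m\<close>;
    moving it to the left produces the factor 2.\<close>
  have tail: "2 * S m = b m 1 * P * S (m + 1) - P ^ 2 * (b m 2 * S (m + 2)) +
      P ^ 3 * R m" if "odd m" for m
  proof -
    have "b m 0 = 1" by (simp add: b_def)
    have "(\<Sum>i\<le>N. S (m + (i + 3)) * b m (i + 3) * (- P) ^ (i + 3)) =
      - (P ^ 3 * R m)"
      by (simp add: R_def sum_distrib_left sum_negf power_add mult_ac add_ac)
    moreover have "(\<Sum>i\<le>N + 3. S (m + i) * b m i * (- P) ^ i) =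
      S m - S (m + 1) * b m 1 * P + S (m + 2) * b m 2 * P ^ 2 +
      (\<Sum>i\<le>N. S (m + (i + 3)) * b m (i + 3) * (- P) ^ (i + 3))"
      using \<open>b m 0 = 1\<close>
      by (simp add: eval_nat_numeral sum.atMost_Suc_shift del: sum.atMost_Suc)
    ultimately show ?thesis using reflect[OF that] by (simp add: algebra_simps)
  qed
  have S: "p_integral p (S j)" if "n \<le> j" for j
    unfolding S_def using p_integral_coeff_sum_poly assms(2,4,6) that by blast
  have b: "p_integral p (b m i)" for m i
    unfolding b_def by (rule p_integral_of_nat[OF assms(4)])
  have P: "p_integral p P"
    unfolding P_def by (rule p_integral_of_nat[OF assms(4)])
  note closed = p_integral_add p_integral_uminus p_integral_mult p_integral_power p_integral_sum
    S b P assms(4)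
  \<comment> \<open>Division by 2 is harmless because \<open>p > 2\<close>.\<close>
  have half: "p_integral p (1 / 2)"
    using p_integral_inverse_of_nat[OF assms(4), of 2] p by simp
  have R: "p_integral p (R m)" if "n \<le> m" for m
    unfolding R_def using that by (intro closed) auto
  \<comment> \<open>\<open>P * W\<close> is the right-hand side of \<open>tail\<close> at the odd
    index \<open>n + 2\<close>, so \<open>p\<close> divides \<open>S (n + 2)\<close>. Signs are kept
    inside sums and products to match the rules in \<open>closed\<close>.\<close>
  define W where "W = b (n + 2) 1 * S (n + 2 + 1)
    + (- P) * (b (n + 2) 2 * S (n + 2 + 2)) + (- P) ^ 2 * R (n + 2)"
  have W: "p_integral p W" unfolding W_def by (intro closed R) auto
  have "2 * S (n + 2) = P * W"
    using tail[of "n + 2"] assms(3)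
    by (simp add: W_def algebra_simps power2_eq_square power3_eq_cube)
  then have S2: "S (n + 2) = P * W / 2" by simp
  \<comment> \<open>Inserting \<open>S2\<close> into \<open>tail\<close> at \<open>n\<close> turns
    the quadratic term into -P^3 (b n 2) W/2. Together with P^3 (R n), halved, this is the whole
    error P^3 Z.\<close>
  define Z where "Z = 1 / 2 * (R n + - (b n 2 * (1 / 2 * W)))"
  have Z: "p_integral p Z" unfolding Z_def by (intro closed half R W) auto
  have "b n 1 = of_nat n + 1" by (simp add: b_def)
  then have "2 * S n = (of_nat n + 1) * P * S (n + 1) + 2 * (P ^ 3 * Z)"
    using tail[OF assms(3)] unfolding S2
    by (simp add: Z_def algebra_simps power2_eq_square power3_eq_cube)
  then have "S n - P * (of_nat n + 1) / 2 * S (n + 1) = P ^ 3 * Z"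
    by (simp add: field_simps)
  then show ?thesis
    using Z assms(2) unfolding p_cong_def by (auto simp: multiple_sum_eq_coeff S_def P_def)
qed

end
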